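(* Let $(M,d)$ be a complete metric space. Then $M$ is a length space if and only if $M$ has property $(Z)$.
   Context: For real numbers $a,b$, write $a\vee b=\max\{a,b\}$ and $a\wedge b=\min\{a,b\}$. Property $(Z)$: a pair $(x,y)$ of points of $M$ with $x\neq y$ has property $(Z)$ if for every $\varepsilon>0$ there exists $z\in M\setminus\{x,y\}$ such that $d(x,z)+d(z,y)\leq d(x,y)+\varepsilon\cdot\big(d(x,z)\wedge d(z,y)\big)$. The space $M$ has property $(Z)$ if each pair of distinct points of $M$ has property $(Z)$. Length space: a complete metric space $M$ is a length space if for every $x,y\in M$ and every $\delta>0$ there exists $z\in M$ such that $d(x,z)\vee d(z,y)\leq d(x,y)/2+\delta$. *)

theory Defs
  imports "HOL-Analysis.Analysis"
begin

context Metric_space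
begin

(* The notion is only used for complete M; completeness is not part of the predicate. *)
definition length_space :: bool where
  "length_space \<longleftrightarrow>
     (\<forall>x\<in>M. \<forall>y\<in>M. \<forall>\<delta>>0. \<exists>z\<in>M. max (d x z) (d z y) \<le> d x y / 2 + \<delta>)"

(* Only meant for distinct points x, y of M. *)
definition pair_property_Z :: "'a \<Rightarrow> 'a \<Rightarrow> bool" where
  "pair_property_Z x y \<longleftrightarrow>
     (\<forall>\<epsilon>>0. \<exists>z\<in>M - {x, y}. d x z + d z y \<le> d x y + \<epsilon> * min (d x z) (d z y))"

definition property_Z :: bool where
  "property_Z \<longleftrightarrow> (\<forall>x\<in>M. \<forall>y\<in>M. x \<noteq> y \<longrightarrow> pair_property_Z x y)"

end

end

theory Submission
  imports Defs
begin

text \<open>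
  A length space has property (Z) because an approximate midpoint of \<open>x\<close> and \<open>y\<close>, taken with a
  small enough error, keeps a definite distance from both points.

  For the converse, let \<open>D = d x0 y0\<close>. The point supplied by property (Z) may lie very close to
  \<open>x\<close> or \<open>y\<close>, so it has to be used repeatedly to close the gap between \<open>x0\<close> and \<open>y0\<close>. Consider
  pairs \<open>(x, y)\<close> with \<open>x\<close> in the closed ball of radius \<open>D / 2\<close> about \<open>x0\<close> and \<open>y\<close> in the closed
  ball of radius \<open>D / 2\<close> about \<open>y0\<close>, and move from a pair to another one when the decrease of
  \<open>d x y\<close> is at least \<open>c < 1\<close> times the total displacement of the two points. The set of these
  pairs is complete, so Ekeland's variational principle yields a pair \<open>(x, y)\<close> that is reachable
  from \<open>(x0, y0)\<close> and from which no further move is possible. If \<open>x = y\<close>, this point lies in both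
  balls and is a midpoint. Otherwise property (Z) gives a point \<open>z\<close> almost between \<open>x\<close> and \<open>y\<close>.
  Because the error in property (Z) is controlled by the \<^emph>\<open>minimum\<close> of the two distances, both
  replacing \<open>x\<close> by \<open>z\<close> and replacing \<open>y\<close> by \<open>z\<close> would be legitimate moves, so \<open>z\<close> lies in neither
  ball. But the detour from \<open>x0\<close> to \<open>y0\<close> through \<open>z\<close> has length at most \<open>D / c\<close>; if \<open>c\<close> is close
  to \<open>1\<close>, a point outside both balls is then an approximate midpoint.
\<close>

section \<open>Ekeland's variational principle\<close>

context Metric_space
begin

text \<open>
  The successors of a point \<open>p\<close> are the points \<open>q\<close> with \<open>f q + d p q \<le> f p\<close>. By transitivity the
  successor sets decrease along a chain of successors. When each next point minimises \<open>f\<close> among the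
  successors of the previous one up to an error \<open>(1/2)^n\<close>, its own successors are within that
  distance of it, so by completeness the successor sets have a common point, and it is the only one.
  Lower semicontinuity of \<open>f\<close> (closed sublevel sets) serves to make the successor sets closed.
\<close>
lemma Ekeland_variational_principle:
  fixes f :: "'a \<Rightarrow> real"
  assumes complete: mcomplete
    and lsc: "\<And>r. closedin mtopology {x \<in> M. f x \<le> r}"
    and bounded: "\<And>x. x \<in> M \<Longrightarrow> b \<le> f x"
    and u: "u \<in> M"
  obtains v where "v \<in> M" "f v + d u v \<le> f u"
    "\<And>w. \<lbrakk>w \<in> M; f w + d v w \<le> f v\<rbrakk> \<Longrightarrow> w = v"
proof -
  define S where "S p = {q \<in> M. f q + d p q \<le> f p}" for p
  have S_self: "p \<in> S p" if "p \<in> M" for p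
    using that by (simp add: S_def)
  have S_trans: "S q \<subseteq> S p" if "p \<in> M" "q \<in> S p" for p q
  proof
    fix r assume "r \<in> S q"
    with that triangle[of p q r] show "r \<in> S p"
      by (auto simp: S_def)
  qed
  have S_closed: "closedin mtopology (S p)" if p: "p \<in> M" for p
  proof -
    \<comment> \<open>A sum is at most \<open>f p\<close> iff no \<open>r\<close> separates its terms; this reduces the claim to sublevel
      sets of \<open>f\<close> and closed balls.\<close>
    have "S p = (\<Inter>r. {q \<in> M. f q \<le> r} \<union> mcball p (f p - r))"
    proof (intro equalityI subsetI)
      fix q assume "q \<in> S p"
      then show "q \<in> (\<Inter>r. {q \<in> M. f q \<le> r} \<union> mcball p (f p - r))"
        using p by (auto simp: S_def)
    next
      fix q assume q: "q \<in> (\<Inter>r. {q \<in> M. f q \<le> r} \<union> mcball p (f p - r))"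
      then have qM: "q \<in> M" by auto
      show "q \<in> S p"
      proof (rule ccontr)
        assume "q \<notin> S p"
        then have "f p - d p q < f q" using qM by (simp add: S_def)
        then obtain r where "f p - d p q < r" "r < f q" using dense by blast
        moreover have "q \<in> {q \<in> M. f q \<le> r} \<union> mcball p (f p - r)" using q by blast
        ultimately show False by auto
      qed
    qed
    moreover have "closedin mtopology (\<Inter>r. {q \<in> M. f q \<le> r} \<union> mcball p (f p - r))"
      by (rule closedin_Inter) (auto intro!: closedin_Un lsc closedin_mcball)
    ultimately show ?thesis by simp
  qed
  have next_ex: "\<exists>q. q \<in> M \<and> (q \<in> S p \<and> (\<forall>w\<in>S p. f q \<le> f w + (1/2) ^ n))"
    if p: "p \<in> M" for p and n :: nat
  proof -
    have bdd: "bdd_below (f ` S p)"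
      by (rule bdd_belowI[of _ b]) (auto simp: S_def bounded)
    have "f ` S p \<noteq> {}" using S_self[OF p] by blast
    then have "\<exists>y\<in>f ` S p. y < Inf (f ` S p) + (1/2) ^ n"
      using cInf_lessD[of "f ` S p" "Inf (f ` S p) + (1/2) ^ n"] by auto
    then obtain q where q: "q \<in> S p" "f q < Inf (f ` S p) + (1/2) ^ n" by blast
    have "f q \<le> f w + (1/2) ^ n" if "w \<in> S p" for w
      using cInf_lower[OF imageI[OF that, of f] bdd] q(2) by linarith
    with q(1) show ?thesis by (auto simp: S_def)
  qed
  obtain p where p_u: "p 0 = u" and pM: "\<And>n. p n \<in> M" and p_step: "\<And>n. p (Suc n) \<in> S (p n)"
    and p_min: "\<And>n w. w \<in> S (p n) \<Longrightarrow> f (p (Suc n)) \<le> f w + (1/2) ^ n"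
  proof -
    have "\<exists>p. \<forall>n. (p n \<in> M \<and> (n = 0 \<longrightarrow> p n = u))
        \<and> (p (Suc n) \<in> S (p n) \<and> (\<forall>w\<in>S (p n). f (p (Suc n)) \<le> f w + (1/2) ^ n))"
      by (rule dependent_nat_choice) (use u next_ex in auto)
    then show thesis using that by metis
  qed
  have S_dec: "decseq (\<lambda>n. S (p n))"
    by (rule decseq_SucI) (rule S_trans[OF pM p_step])
  have near: "d (p (Suc n)) w \<le> (1/2) ^ n" if "w \<in> S (p (Suc n))" for n w
    using p_min[of w n] that S_trans[OF pM[of n] p_step[of n]] by (force simp: S_def)
  have small: "\<exists>n a. S (p n) \<subseteq> mcball a \<epsilon>" if "\<epsilon> > 0" for \<epsilon> :: real
  proof -
    obtain n where "(1/2) ^ n < \<epsilon>"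
      using real_arch_pow_inv[OF \<open>\<epsilon> > 0\<close>, of "1/2"] by auto
    then have "S (p (Suc n)) \<subseteq> mcball (p (Suc n)) \<epsilon>"
      using near[of _ n] pM[of "Suc n"] by (fastforce simp: S_def)
    then show ?thesis by blast
  qed
  have "(\<Inter>n. S (p n)) \<noteq> {}"
    using complete[unfolded mcomplete_nest, rule_format, of "\<lambda>n. S (p n)"]
      S_closed[OF pM] S_self[OF pM] S_dec small by blast
  then obtain v where v: "\<And>n. v \<in> S (p n)" by blast
  have vM: "v \<in> M" using v[of 0] by (simp add: S_def)
  show thesis
  proof
    show "v \<in> M" by (fact vM)
    show "f v + d u v \<le> f u" using v[of 0] by (simp add: S_def p_u)
  next
    fix w assume w: "w \<in> M" "f w + d v w \<le> f v"
    then have "w \<in> S v" by (simp add: S_def)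
    then have wS: "w \<in> S (p n)" for n using S_trans[OF pM v] by blast
    have "d w v \<le> 0"
    proof (rule field_le_epsilon)
      fix \<epsilon> :: real assume "\<epsilon> > 0"
      then obtain n where n: "(1/2) ^ n < \<epsilon> / 2"
        using real_arch_pow_inv[of "\<epsilon> / 2" "1/2"] by auto
      have "d w v \<le> d (p (Suc n)) w + d (p (Suc n)) v"
        using triangle[OF w(1) pM vM, of "Suc n"]
        by (simp add: commute)
      with near[OF wS, of n] near[OF v, of n] n show "d w v \<le> 0 + \<epsilon>" by linarith
    qed
    with w(1) vM show "w = v" using nonneg[of w v] zero[of w v] by linarith
  qed
qed

section \<open>Pairs of points with the sum metric\<close>

text \<open>
  The sum is chosen among the equivalent product metrics because \<open>sum_dist (x0, y0) (x, y) + d x y\<close>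
  is then the length of the path from \<open>x0\<close> to \<open>y0\<close> through \<open>x\<close> and \<open>y\<close>, which has to be compared
  with \<open>d x0 y0\<close> without a constant factor.
\<close>
definition sum_dist :: "'a \<times> 'a \<Rightarrow> 'a \<times> 'a \<Rightarrow> real" where
  "sum_dist p q = d (fst p) (fst q) + d (snd p) (snd q)"

lemma Metric_space_sum_dist:
  assumes "A \<subseteq> M" "B \<subseteq> M"
  shows "Metric_space (A \<times> B) sum_dist"
proof
  fix p q :: "'a \<times> 'a"
  show "0 \<le> sum_dist p q" by (simp add: sum_dist_def)
  show "sum_dist p q = sum_dist q p" by (simp add: sum_dist_def commute)
next
  fix p q assume "p \<in> A \<times> B" "q \<in> A \<times> B"
  then show "sum_dist p q = 0 \<longleftrightarrow> p = q"
    using assms by (auto simp: sum_dist_def add_nonneg_eq_0_iff subset_iff)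
next
  fix p q r assume "p \<in> A \<times> B" "q \<in> A \<times> B" "r \<in> A \<times> B"
  then have "d (fst p) (fst r) \<le> d (fst p) (fst q) + d (fst q) (fst r)"
    "d (snd p) (snd r) \<le> d (snd p) (snd q) + d (snd q) (snd r)"
    using assms by (auto intro!: triangle)
  then show "sum_dist p r \<le> sum_dist p q + sum_dist q r"
    by (simp add: sum_dist_def)
qed

lemma mcomplete_sum_dist:
  assumes complete: mcomplete and A: "closedin mtopology A" and B: "closedin mtopology B"
  shows "Metric_space.mcomplete (A \<times> B) sum_dist"
proof -
  have AM: "A \<subseteq> M" and BM: "B \<subseteq> M" using A B closedin_metric by blast+
  interpret P: Metric_space "A \<times> B" sum_dist by (rule Metric_space_sum_dist[OF AM BM])
  show ?thesis
    unfolding P.mcomplete_def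
  proof (intro allI impI)
    fix \<sigma> assume \<sigma>: "P.MCauchy \<sigma>"
    then have ran: "\<sigma> n \<in> A \<times> B" for n by (auto simp: P.MCauchy_def)
    have Cauchy: "\<exists>N. \<forall>n n'. N \<le> n \<longrightarrow> N \<le> n' \<longrightarrow> d (g (\<sigma> n)) (g (\<sigma> n')) < \<epsilon>"
      if le: "\<And>p q. d (g p) (g q) \<le> sum_dist p q" and "\<epsilon> > 0" for g \<epsilon>
      using \<sigma> \<open>\<epsilon> > 0\<close> le_less_trans[OF le] unfolding P.MCauchy_def by meson
    have "MCauchy (fst \<circ> \<sigma>)"
      using ran AM Cauchy[of fst]
      by (auto simp: MCauchy_def image_subset_iff mem_Times_iff sum_dist_def)
    moreover have "MCauchy (snd \<circ> \<sigma>)"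
      using ran BM Cauchy[of snd]
      by (auto simp: MCauchy_def image_subset_iff mem_Times_iff sum_dist_def)
    ultimately obtain x y where x: "limitin mtopology (fst \<circ> \<sigma>) x sequentially"
      and y: "limitin mtopology (snd \<circ> \<sigma>) y sequentially"
      using complete unfolding mcomplete_def by meson
    have "range (fst \<circ> \<sigma>) \<subseteq> A" "range (snd \<circ> \<sigma>) \<subseteq> B"
      using ran by (auto simp: mem_Times_iff)
    with A B x y have "x \<in> A" "y \<in> B"
      unfolding metric_closedin_iff_sequentially_closed by meson+
    moreover have "(\<lambda>n. sum_dist (\<sigma> n) (x, y)) \<longlonglongrightarrow> 0"
      using x y tendsto_add[of "\<lambda>n. d (fst (\<sigma> n)) x" 0 _ "\<lambda>n. d (snd (\<sigma> n)) y" 0]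
      by (simp add: limitin_metric_dist_null sum_dist_def)
    ultimately have "limitin P.mtopology \<sigma> (x, y) sequentially"
      using ran by (simp add: P.limitin_metric_dist_null)
    then show "\<exists>p. limitin P.mtopology \<sigma> p sequentially" ..
  qed
qed

lemma closedin_dist_sublevel:
  assumes "A \<subseteq> M" "B \<subseteq> M"
  shows "closedin (Metric_space.mtopology (A \<times> B) sum_dist) {p \<in> A \<times> B. d (fst p) (snd p) \<le> r}"
proof -
  interpret P: Metric_space "A \<times> B" sum_dist by (rule Metric_space_sum_dist[OF assms])
  show ?thesis
    unfolding P.metric_closedin_iff_sequentially_closed
  proof (intro conjI allI impI)
    fix \<sigma> l
    assume "range \<sigma> \<subseteq> {p \<in> A \<times> B. d (fst p) (snd p) \<le> r} \<and> limitin P.mtopology \<sigma> l sequentially"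
    then have \<sigma>: "\<And>n. \<sigma> n \<in> A \<times> B" "\<And>n. d (fst (\<sigma> n)) (snd (\<sigma> n)) \<le> r"
      and l: "l \<in> A \<times> B" and lim: "(\<lambda>n. sum_dist (\<sigma> n) l) \<longlonglongrightarrow> 0"
      by (auto simp: P.limitin_metric_dist_null)
    have "d (fst l) (snd l) \<le> r + sum_dist (\<sigma> n) l" for n
    proof -
      have M: "fst l \<in> M" "snd l \<in> M" "fst (\<sigma> n) \<in> M" "snd (\<sigma> n) \<in> M"
        using l \<sigma>(1)[of n] assms by auto
      show ?thesis
        using triangle[OF M(1,3,2)] triangle[OF M(3,4,2)] \<sigma>(2)[of n]
        by (simp add: sum_dist_def commute)
    qed
    moreover have "(\<lambda>n. r + sum_dist (\<sigma> n) l) \<longlonglongrightarrow> r"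
      using tendsto_add[OF tendsto_const lim, of r] by simp
    ultimately have "d (fst l) (snd l) \<le> r" by (auto intro: LIMSEQ_le_const)
    with l show "l \<in> {p \<in> A \<times> B. d (fst p) (snd p) \<le> r}" by blast
  qed blast
qed

section \<open>Length spaces and property (Z)\<close>

lemma length_space_imp_property_Z:
  assumes length_space
  shows property_Z
  unfolding property_Z_def pair_property_Z_def
proof (intro ballI impI allI)
  fix x y and \<epsilon> :: real
  assume x: "x \<in> M" and y: "y \<in> M" and "x \<noteq> y" and \<epsilon>: "\<epsilon> > 0"
  define D where "D = d x y"
  have D: "D > 0" using x y \<open>x \<noteq> y\<close> by (simp add: D_def)
  \<comment> \<open>\<open>D / 4\<close> keeps the point at distance \<open>D / 4\<close> or more from \<open>x\<close> and \<open>y\<close>; \<open>\<epsilon> * D / 8\<close> bounds the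
    excess \<open>2 * \<delta>\<close> by \<open>\<epsilon>\<close> times that distance.\<close>
  define \<delta> where "\<delta> = min (D / 4) (\<epsilon> * D / 8)"
  have "\<delta> > 0" using D \<epsilon> by (simp add: \<delta>_def)
  then obtain z where z: "z \<in> M" "d x z \<le> D / 2 + \<delta>" "d z y \<le> D / 2 + \<delta>"
    using assms x y by (force simp: length_space_def D_def)
  have \<delta>: "\<delta> \<le> D / 4" "\<delta> \<le> \<epsilon> * D / 8" by (simp_all add: \<delta>_def)
  have far: "D / 4 \<le> min (d x z) (d z y)"
    using triangle[OF x z(1) y] z \<delta> D_def by auto
  have "\<epsilon> * (D / 4) \<le> \<epsilon> * min (d x z) (d z y)"
    using far \<epsilon> by (intro mult_left_mono) auto
  then have "d x z + d z y \<le> d x y + \<epsilon> * min (d x z) (d z y)"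
    using z \<delta> by (simp add: D_def)
  moreover have "z \<noteq> x" "z \<noteq> y" using far D x y by auto
  ultimately show "\<exists>z\<in>M - {x, y}. d x z + d z y \<le> d x y + \<epsilon> * min (d x z) (d z y)"
    using z(1) by blast
qed

lemma property_Z_imp_length_space:
  assumes complete: mcomplete and Z: property_Z
  shows length_space
  unfolding length_space_def
proof (intro ballI impI allI)
  fix x0 y0 and \<delta> :: real
  assume x0: "x0 \<in> M" and y0: "y0 \<in> M" and \<delta>: "\<delta> > 0"
  define D where "D = d x0 y0"
  have D: "D \<ge> 0" by (simp add: D_def)
  \<comment> \<open>Close enough to \<open>1\<close> that \<open>D / c \<le> D + \<delta>\<close>.\<close>
  define c where "c = (D + \<delta> / 2) / (D + \<delta>)"
  have c: "0 < c" "c < 1" "D / c \<le> D + \<delta>"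
    using D \<delta> by (auto simp: c_def field_simps)
  define A where "A = mcball x0 (D / 2)"
  define B where "B = mcball y0 (D / 2)"
  have A: "closedin mtopology A" and B: "closedin mtopology B" by (auto simp: A_def B_def)
  have AM: "A \<subseteq> M" and BM: "B \<subseteq> M" by (auto simp: A_def B_def)
  interpret P: Metric_space "A \<times> B" sum_dist by (rule Metric_space_sum_dist[OF AM BM])
  define f where "f p = d (fst p) (snd p) / c" for p
  have f_le: "f p \<le> r \<longleftrightarrow> d (fst p) (snd p) \<le> r * c" for p r
    using c by (simp add: f_def pos_divide_le_eq)
  obtain v where v: "v \<in> A \<times> B" "f v + sum_dist (x0, y0) v \<le> f (x0, y0)"
    and v_min: "\<And>w. \<lbrakk>w \<in> A \<times> B; f w + sum_dist v w \<le> f v\<rbrakk> \<Longrightarrow> w = v"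
  proof (rule P.Ekeland_variational_principle)
    show "P.mcomplete" by (rule mcomplete_sum_dist[OF complete A B])
    show "closedin P.mtopology {p \<in> A \<times> B. f p \<le> r}" for r
      unfolding f_le by (rule closedin_dist_sublevel[OF AM BM])
    show "0 \<le> f p" for p using c by (simp add: f_def)
    show "(x0, y0) \<in> A \<times> B" using x0 y0 D by (simp add: A_def B_def)
  qed blast
  obtain x y where xy: "v = (x, y)" "x \<in> A" "y \<in> B" using v(1) by auto
  have x: "x \<in> M" and y: "y \<in> M" using xy AM BM by auto
  have reach: "d x y / c + d x0 x + d y y0 \<le> D / c"
    using v(2) xy by (simp add: f_def sum_dist_def D_def commute)
  show "\<exists>z\<in>M. max (d x0 z) (d z y0) \<le> d x0 y0 / 2 + \<delta>"
  proof (cases "x = y")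
    case True
    with xy have "max (d x0 x) (d x y0) \<le> d x0 y0 / 2 + \<delta>"
      using \<delta> by (auto simp: A_def B_def D_def commute)
    with x show ?thesis by blast
  next
    case False
    moreover have "1 - c > 0" using c by simp
    ultimately obtain z where z: "z \<in> M" "z \<noteq> x" "z \<noteq> y"
      and zle: "d x z + d z y \<le> d x y + (1 - c) * min (d x z) (d z y)"
      using Z x y unfolding property_Z_def pair_property_Z_def by blast
    have step: "d z y / c + d x z \<le> d x y / c" "d x z / c + d z y \<le> d x y / c"
    proof -
      have "(1 - c) * min (d x z) (d z y) \<le> (1 - c) * d x z"
        "(1 - c) * min (d x z) (d z y) \<le> (1 - c) * d z y"
        using c by (auto intro!: mult_left_mono)
      with zle have "d z y + d x z * c \<le> d x y" "d x z + d z y * c \<le> d x y"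
        by (auto simp: algebra_simps)
      then have "(d z y + d x z * c) / c \<le> d x y / c" "(d x z + d z y * c) / c \<le> d x y / c"
        using c by (auto intro!: divide_right_mono)
      then show "d z y / c + d x z \<le> d x y / c" "d x z / c + d z y \<le> d x y / c"
        using c by (simp_all add: add_divide_distrib)
    qed
    have "z \<notin> A"
      using v_min[of "(z, y)"] step(1) z xy y by (auto simp: f_def sum_dist_def)
    moreover have "z \<notin> B"
      using v_min[of "(x, z)"] step(2) z xy x y by (auto simp: f_def sum_dist_def commute)
    ultimately have out: "d x0 z > D / 2" "d z y0 > D / 2"
      using z(1) x0 y0 by (auto simp: A_def B_def commute)
    have "d z y \<le> d z y / c"
      using c by (simp add: pos_le_divide_eq mult_left_le)
    then have "d x0 z + d z y0 \<le> D + \<delta>"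
      using reach step(1) c(3) triangle[OF x0 x z(1)] triangle[OF z(1) y y0] by linarith
    with out have "max (d x0 z) (d z y0) \<le> d x0 y0 / 2 + \<delta>"
      by (simp add: D_def)
    with z(1) show ?thesis by blast
  qed
qed

end

theorem mainTheorem1:
  fixes M :: "'a set" and d :: "'a \<Rightarrow> 'a \<Rightarrow> real"
  assumes "Metric_space M d"
    and "Metric_space.mcomplete M d"
  shows "Metric_space.length_space M d \<longleftrightarrow> Metric_space.property_Z M d"
  using Metric_space.length_space_imp_property_Z[OF assms(1)]
    Metric_space.property_Z_imp_length_space[OF assms]
  by (rule iffI)

end
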